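(* Let $\Phi\subseteq\mathbb R^d$ be a vertex reflexive isometric tight frame, and let $K=\operatorname{conv}(\Phi)$ be the convex polytope it generates. Then $\mathcal W^{\max}(K)\subseteq d\,\mathcal W^{\min}(K)$.
   Context: A finite set $\Phi=\{v_1,\dots,v_N\}$ of distinct vectors in $\mathbb R^d$ is a tight frame if there is $\sigma>0$ with $\sum_i|\langle x,v_i\rangle|^2=\sigma\|x\|^2$ for all $x\in\mathbb R^d$; it is isometric if all $v_i$ have the same length $\ell>0$. $\operatorname{Sym}(\Phi)$ is the group of linear isometries $U$ of $\mathbb R^d$ with $U\Phi=\Phi$, and $\operatorname{Stab}(v)=\{U\in\operatorname{Sym}(\Phi):Uv=v\}$. $\Phi$ is vertex reflexive if for every $i$ the space of vectors fixed by every element of $\operatorname{Stab}(v_i)$ has dimension exactly one, namely $\operatorname{span}\{v_i\}$. $(M_n)^d_{sa}$ is the set of $d$-tuples of self-adjoint $n\times n$ complex matrices. For a closed convex $K\subseteq\mathbb R^d$: $\mathcal W^{\min}(K)=\bigcup_n\mathcal W^{\min}_n(K)$, where $\mathcal W^{\min}_n(K)$ is the set of $X\in(M_n)^d_{sa}$ for which there are a tuple $N$ of commuting normal operators on a Hilbert space $L$ with joint spectrum $\sigma(N)\subseteq K$ and an isometry $V:\mathbb C^n\to L$ with $X_i=V^*N_iV$ for all $i$; and $\mathcal W^{\max}(K)=\bigcup_n\mathcal W^{\max}_n(K)$, where $\mathcal W^{\max}_n(K)$ is the set of $X\in(M_n)^d_{sa}$ such that $\sum_i\alpha_iX_i\le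 aI_n$ whenever $\alpha\in\mathbb R^d$, $a\in\mathbb R$ satisfy $\sum_i\alpha_ix_i\le a$ for all $x\in K$. $c\,\mathcal S=\{cX:X\in\mathcal S\}$; inclusion means inclusion at every level $n$. *)

theory Defs
  imports "HOL-Analysis.Analysis" "Jordan_Normal_Form.Schur_Decomposition"
begin

no_notation vec_index (infixl \<open>$\<close> 100)

section \<open>Vertex reflexive isometric tight frames\<close>

text \<open>The vectors of a frame are pairwise distinct, so a frame is a set of vectors.\<close>

definition tight_frame :: "(real ^ 'd) set \<Rightarrow> bool" where
  "tight_frame \<Phi> \<longleftrightarrow> finite \<Phi> \<and>
     (\<exists>\<sigma>>0. \<forall>x. (\<Sum>v\<in>\<Phi>. \<bar>inner x v\<bar>\<^sup>2) = \<sigma> * (norm x)\<^sup>2)"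

definition isometric_frame :: "(real ^ 'd) set \<Rightarrow> bool" where
  "isometric_frame \<Phi> \<longleftrightarrow> (\<exists>l>0. \<forall>v\<in>\<Phi>. norm v = l)"

definition frame_Sym :: "(real ^ 'd) set \<Rightarrow> (real ^ 'd \<Rightarrow> real ^ 'd) set" where
  "frame_Sym \<Phi> = {U. orthogonal_transformation U \<and> U ` \<Phi> = \<Phi>}"

definition frame_Stab :: "(real ^ 'd) set \<Rightarrow> real ^ 'd \<Rightarrow> (real ^ 'd \<Rightarrow> real ^ 'd) set" where
  "frame_Stab \<Phi> v = {U \<in> frame_Sym \<Phi>. U v = v}"

definition frame_Fix :: "(real ^ 'd) set \<Rightarrow> real ^ 'd \<Rightarrow> (real ^ 'd) set" where
  "frame_Fix \<Phi> v = {x. \<forall>U\<in>frame_Stab \<Phi> v. U x = x}"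

definition vertex_reflexive :: "(real ^ 'd) set \<Rightarrow> bool" where
  "vertex_reflexive \<Phi> \<longleftrightarrow>
     (\<forall>v\<in>\<Phi>. dim (frame_Fix \<Phi> v) = 1 \<and> frame_Fix \<Phi> v = span {v})"

section \<open>Complex Hilbert spaces and their bounded operators\<close>

text \<open>
  A Hilbert space is presented on a carrier set, so that one can quantify existentially over
  Hilbert spaces inside a formula.  The vector space structure is that of a module over the
  field \<^term>\<open>class_ring :: complex ring\<close>; the fields \<open>mult\<close> and \<open>one\<close> inherited
  from the module record are not used.  The inner product is linear in its first argument.
\<close>

record 'h ip_space = "(complex, 'h) module" +
  ip :: "'h \<Rightarrow> 'h \<Rightarrow> complex"

definition ip_norm :: "'h ip_space \<Rightarrow> 'h \<Rightarrow> real" where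
  "ip_norm H x = sqrt (Re (ip H x x))"

definition inner_product_space :: "'h ip_space \<Rightarrow> bool" where
  "inner_product_space H \<longleftrightarrow>
     module (class_ring :: complex ring) H \<and>
     (\<forall>x\<in>carrier H. \<forall>y\<in>carrier H. \<forall>z\<in>carrier H.
        ip H (x \<oplus>\<^bsub>H\<^esub> y) z = ip H x z + ip H y z) \<and>
     (\<forall>c. \<forall>x\<in>carrier H. \<forall>y\<in>carrier H. ip H (c \<odot>\<^bsub>H\<^esub> x) y = c * ip H x y) \<and>
     (\<forall>x\<in>carrier H. \<forall>y\<in>carrier H. ip H y x = cnj (ip H x y)) \<and>
     (\<forall>x\<in>carrier H. 0 \<le> Re (ip H x x) \<and> (ip H x x = 0 \<longrightarrow> x = \<zero>\<^bsub>H\<^esub>))"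

definition complete_ip_space :: "'h ip_space \<Rightarrow> bool" where
  "complete_ip_space H \<longleftrightarrow>
     (\<forall>f :: nat \<Rightarrow> 'h. range f \<subseteq> carrier H \<longrightarrow>
        (\<forall>e>0. \<exists>M. \<forall>p\<ge>M. \<forall>q\<ge>M. ip_norm H (f p \<ominus>\<^bsub>H\<^esub> f q) < e) \<longrightarrow>
        (\<exists>l\<in>carrier H. (\<lambda>k. ip_norm H (f k \<ominus>\<^bsub>H\<^esub> l)) \<longlonglongrightarrow> 0))"

definition hilbert_space :: "'h ip_space \<Rightarrow> bool" where
  "hilbert_space H \<longleftrightarrow> inner_product_space H \<and> complete_ip_space H"

definition cn_space :: "nat \<Rightarrow> complex vec ip_space" where
  "cn_space n = module.extend (module_vec TYPE(complex) n) (ip_space.fields (\<lambda>x y. x \<bullet>c y))"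

definition linear_op :: "'g ip_space \<Rightarrow> 'h ip_space \<Rightarrow> ('g \<Rightarrow> 'h) \<Rightarrow> bool" where
  "linear_op G H T \<longleftrightarrow> T \<in> carrier G \<rightarrow> carrier H \<and>
     (\<forall>x\<in>carrier G. \<forall>y\<in>carrier G. T (x \<oplus>\<^bsub>G\<^esub> y) = T x \<oplus>\<^bsub>H\<^esub> T y) \<and>
     (\<forall>c. \<forall>x\<in>carrier G. T (c \<odot>\<^bsub>G\<^esub> x) = c \<odot>\<^bsub>H\<^esub> T x)"

definition bounded_op :: "'g ip_space \<Rightarrow> 'h ip_space \<Rightarrow> ('g \<Rightarrow> 'h) \<Rightarrow> bool" where
  "bounded_op G H T \<longleftrightarrow> linear_op G H T \<and>
     (\<exists>B. \<forall>x\<in>carrier G. ip_norm H (T x) \<le> B * ip_norm G x)"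

text \<open>\<open>is_adjoint G H T S\<close> says that \<open>S = T\<^sup>*\<close> (on the carrier of \<open>H\<close>).\<close>

definition is_adjoint :: "'g ip_space \<Rightarrow> 'h ip_space \<Rightarrow> ('g \<Rightarrow> 'h) \<Rightarrow> ('h \<Rightarrow> 'g) \<Rightarrow> bool" where
  "is_adjoint G H T S \<longleftrightarrow> bounded_op H G S \<and>
     (\<forall>x\<in>carrier G. \<forall>y\<in>carrier H. ip H (T x) y = ip G x (S y))"

definition isometry_op :: "'g ip_space \<Rightarrow> 'h ip_space \<Rightarrow> ('g \<Rightarrow> 'h) \<Rightarrow> bool" where
  "isometry_op G H V \<longleftrightarrow> linear_op G H V \<and> (\<forall>x\<in>carrier G. ip_norm H (V x) = ip_norm G x)"

definition normal_op :: "'h ip_space \<Rightarrow> ('h \<Rightarrow> 'h) \<Rightarrow> bool" where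
  "normal_op H T \<longleftrightarrow> bounded_op H H T \<and>
     (\<exists>S. is_adjoint H H T S \<and> (\<forall>x\<in>carrier H. S (T x) = T (S x)))"

definition commuting_normal_tuple :: "'h ip_space \<Rightarrow> ('d \<Rightarrow> 'h \<Rightarrow> 'h) \<Rightarrow> bool" where
  "commuting_normal_tuple H N \<longleftrightarrow> (\<forall>i. normal_op H (N i)) \<and>
     (\<forall>i j. \<forall>x\<in>carrier H. N i (N j x) = N j (N i x))"

text \<open>
  Joint spectrum of a commuting tuple in the algebra of bounded operators: \<open>\<mu>\<close> is outside
  it iff the operators \<open>N\<^sub>i - \<mu>\<^sub>i\<close> generate neither a proper left nor a proper right ideal,
  i.e. both \<open>\<Sum>\<^sub>i B\<^sub>i (N\<^sub>i - \<mu>\<^sub>i) = I\<close> and \<open>\<Sum>\<^sub>i (N\<^sub>i - \<mu>\<^sub>i) C\<^sub>i = I\<close> are solvable by bounded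
  operators.  For commuting normal operators this is the set of points
  \<open>(\<phi>(N\<^sub>1), \<dots>, \<phi>(N\<^sub>d))\<close> with \<open>\<phi>\<close> a character of the C*-algebra they generate,
  and equally the support of the joint spectral measure.
\<close>

definition joint_spectrum :: "'h ip_space \<Rightarrow> ('d::finite \<Rightarrow> 'h \<Rightarrow> 'h) \<Rightarrow> (complex ^ 'd) set" where
  "joint_spectrum H N = {\<mu>. \<not>
     ((\<exists>B. (\<forall>i. bounded_op H H (B i)) \<and>
        (\<forall>x\<in>carrier H. (\<Oplus>\<^bsub>H\<^esub>i\<in>UNIV. B i (N i x \<ominus>\<^bsub>H\<^esub> \<mu> $ i \<odot>\<^bsub>H\<^esub> x)) = x)) \<and>
      (\<exists>C. (\<forall>i. bounded_op H H (C i)) \<and>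
        (\<forall>x\<in>carrier H. (\<Oplus>\<^bsub>H\<^esub>i\<in>UNIV. N i (C i x) \<ominus>\<^bsub>H\<^esub> \<mu> $ i \<odot>\<^bsub>H\<^esub> C i x) = x)))}"

definition complex_points :: "(real ^ 'd) set \<Rightarrow> (complex ^ 'd) set" where
  "complex_points K = (\<lambda>x. \<chi> i. complex_of_real (x $ i)) ` K"

section \<open>The minimal and maximal matrix convex sets over \<open>K\<close>\<close>

definition sa_tuples :: "nat \<Rightarrow> ('d \<Rightarrow> complex mat) set" where
  "sa_tuples n = {X. \<forall>i. X i \<in> carrier_mat n n \<and> mat_adjoint (X i) = X i}"

text \<open>The order \<open>\<le>\<close> of the matrix library is entrywise, hence a separate Loewner order.\<close>

definition psd_mat :: "nat \<Rightarrow> complex mat \<Rightarrow> bool" where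
  "psd_mat n A \<longleftrightarrow> A \<in> carrier_mat n n \<and> mat_adjoint A = A \<and>
     (\<forall>x\<in>carrier_vec n. 0 \<le> Re ((A *\<^sub>v x) \<bullet>c x))"

definition loewner_le :: "nat \<Rightarrow> complex mat \<Rightarrow> complex mat \<Rightarrow> bool" where
  "loewner_le n A B \<longleftrightarrow> psd_mat n (B - A)"

definition lin_comb_mat :: "nat \<Rightarrow> real ^ 'd \<Rightarrow> ('d::finite \<Rightarrow> complex mat) \<Rightarrow> complex mat" where
  "lin_comb_mat n \<alpha> X = mat n n (\<lambda>(p, q). \<Sum>i\<in>UNIV. complex_of_real (\<alpha> $ i) * X i $$ (p, q))"

text \<open>
  The Hilbert space \<open>L\<close> of a dilation ranges over all Hilbert spaces with carrier a set of
  sequences \<^typ>\<open>nat \<Rightarrow> complex\<close> (with arbitrary operations), that is, up to unitary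
  equivalence, over all Hilbert spaces of cardinality at most the continuum.  These include all
  separable ones, and this is no restriction: given any dilation of \<open>X\<close>, one may replace \<open>L\<close> by
  the separable reducing subspace generated by the range of \<open>V\<close>, which does not enlarge the
  joint spectrum.
\<close>

definition Wmin_level :: "nat \<Rightarrow> (real ^ 'd) set \<Rightarrow> ('d::finite \<Rightarrow> complex mat) set" where
  "Wmin_level n K = {X \<in> sa_tuples n.
     \<exists>(L :: (nat \<Rightarrow> complex) ip_space) N V V'.
       hilbert_space L \<and> commuting_normal_tuple L N \<and>
       joint_spectrum L N \<subseteq> complex_points K \<and>
       isometry_op (cn_space n) L V \<and> is_adjoint (cn_space n) L V V' \<and>
       (\<forall>i. \<forall>x\<in>carrier_vec n. X i *\<^sub>v x = V' (N i (V x)))}"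

definition Wmax_level :: "nat \<Rightarrow> (real ^ 'd) set \<Rightarrow> ('d::finite \<Rightarrow> complex mat) set" where
  "Wmax_level n K = {X \<in> sa_tuples n.
     \<forall>\<alpha> a. (\<forall>x\<in>K. (\<Sum>i\<in>UNIV. \<alpha> $ i * x $ i) \<le> a) \<longrightarrow>
       loewner_le n (lin_comb_mat n \<alpha> X) (complex_of_real a \<cdot>\<^sub>m 1\<^sub>m n)}"

text \<open>
  Level \<open>n\<close> consists of tuples of \<open>n \<times> n\<close> matrices, so the unions below are disjoint and
  inclusion of unions is inclusion at every level.
\<close>

definition Wmin :: "(real ^ 'd) set \<Rightarrow> ('d::finite \<Rightarrow> complex mat) set" where
  "Wmin K = (\<Union>n\<in>{1..}. Wmin_level n K)"

definition Wmax :: "(real ^ 'd) set \<Rightarrow> ('d::finite \<Rightarrow> complex mat) set" where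
  "Wmax K = (\<Union>n\<in>{1..}. Wmax_level n K)"

definition scale_tuples :: "real \<Rightarrow> ('d \<Rightarrow> complex mat) set \<Rightarrow> ('d \<Rightarrow> complex mat) set" where
  "scale_tuples c S = (\<lambda>X i. complex_of_real c \<cdot>\<^sub>m X i) ` S"

end

theory Submission
  imports Defs
begin

text \<open>
  Write \<open>l\<close> for the common length of the vectors of \<open>\<Phi>\<close> and \<open>d\<close> for the dimension.  The orthogonal
  projection \<open>v v\<^sup>T / l\<^sup>2\<close> onto the line of \<open>v \<in> \<Phi>\<close> maps \<open>K\<close> into \<open>K\<close>, because it sends \<open>x \<in> \<Phi>\<close> to the average
  of its orbit under the stabiliser of \<open>v\<close>; and by tightness the average of these projections over \<open>\<Phi>\<close>
  is \<open>I / d\<close>.  Hence \<open>X / d\<close> is the average over \<open>v\<close> of the tuples \<open>v \<otimes> A\<^sub>v / l\<^sup>2\<close> with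
  \<open>A\<^sub>v = \<Sum>\<^sub>j v\<^sub>j X\<^sub>j\<close>.  If \<open>X\<close> lies in the maximal set, then \<open>A\<^sub>v\<close> lies between the minimum and the maximum
  of \<open>\<langle>v, \<cdot>\<rangle>\<close> on \<open>\<Phi>\<close>, so it is a combination of these two numbers with positive semidefinite
  coefficients summing to the identity; the corresponding multiples of \<open>v\<close> are in \<open>K\<close>.  Splitting the
  coefficients into rank one matrices dilates \<open>X / d\<close> to diagonal matrices whose joint eigenvalues
  are in \<open>K\<close>.
\<close>

section \<open>Coordinate Hilbert spaces and multiplication operators\<close>

text \<open>A copy of C^m with carrier in \<open>nat \<Rightarrow> complex\<close>, the type over
  which \<open>Wmin_level\<close> quantifies. Vanishing from \<open>m\<close> on makes a vector
  determined by the coordinates that the inner product sees.\<close>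

definition coord_space :: "nat \<Rightarrow> (nat \<Rightarrow> complex) ip_space" where
  "coord_space m = \<lparr>carrier = {f. \<forall>k\<ge>m. f k = 0}, mult = undefined, one = undefined,
     zero = (\<lambda>_. 0), add = (\<lambda>f g k. f k + g k), smult = (\<lambda>c f k. c * f k),
     ip = (\<lambda>f g. \<Sum>k<m. f k * cnj (g k))\<rparr>"

lemma coord_space_simps:
  "carrier (coord_space m) = {f. \<forall>k\<ge>m. f k = 0}"
  "\<zero>\<^bsub>coord_space m\<^esub> = (\<lambda>_. 0)"
  "f \<oplus>\<^bsub>coord_space m\<^esub> g = (\<lambda>k. f k + g k)"
  "c \<odot>\<^bsub>coord_space m\<^esub> f = (\<lambda>k. c * f k)"
  "ip (coord_space m) f g = (\<Sum>k<m. f k * cnj (g k))"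
  by (simp_all add: coord_space_def)

lemma mult_cnj_cmod: "z * cnj z = complex_of_real ((cmod z)\<^sup>2)"
  by (simp only: complex_norm_square)

lemma ip_norm_coord_space: "ip_norm (coord_space m) f = L2_set (\<lambda>k. cmod (f k)) {..<m}"
  by (simp add: ip_norm_def coord_space_simps L2_set_def mult_cnj_cmod
      flip: of_real_power of_real_sum)

lemma abelian_group_coord_space: "abelian_group (coord_space m)"
proof (rule abelian_groupI)
  fix f assume "f \<in> carrier (coord_space m)"
  then show "\<exists>g\<in>carrier (coord_space m). g \<oplus>\<^bsub>coord_space m\<^esub> f = \<zero>\<^bsub>coord_space m\<^esub>"
    by (intro bexI[of _ "\<lambda>k. - f k"]) (auto simp: coord_space_simps)
qed (auto simp: coord_space_simps ac_simps)

lemma coord_space_minus: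
  assumes "f \<in> carrier (coord_space m)" "g \<in> carrier (coord_space m)"
  shows "f \<ominus>\<^bsub>coord_space m\<^esub> g = (\<lambda>k. f k - g k)"
proof -
  interpret abelian_group "coord_space m" by (rule abelian_group_coord_space)
  have "\<ominus>\<^bsub>coord_space m\<^esub> g = (\<lambda>k. - g k)"
    using assms by (intro minus_equality) (auto simp: coord_space_simps)
  then show ?thesis by (simp add: a_minus_def coord_space_simps)
qed

lemma coord_space_finsum:
  assumes "finite A" "F \<in> A \<rightarrow> carrier (coord_space m)"
  shows "(\<Oplus>\<^bsub>coord_space m\<^esub>i\<in>A. F i) = (\<lambda>k. \<Sum>i\<in>A. F i k)"
proof -
  interpret abelian_group "coord_space m" by (rule abelian_group_coord_space)
  show ?thesis using assms
  proof (induction A rule: finite_induct)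
    case (insert i A)
    then have "(\<Oplus>\<^bsub>coord_space m\<^esub>j\<in>insert i A. F j) = F i \<oplus>\<^bsub>coord_space m\<^esub> (\<Oplus>\<^bsub>coord_space m\<^esub>j\<in>A. F j)"
      by (intro finsum_insert) auto
    with insert show ?case by (simp add: coord_space_simps)
  qed (simp add: coord_space_simps)
qed

lemma module_coord_space: "module (class_ring :: complex ring) (coord_space m)"
proof (rule moduleI)
  show "cring (class_ring :: complex ring)"
    using vec_module[where 'a=complex] module.axioms(1) by blast
qed (use abelian_group_coord_space in \<open>auto simp: coord_space_simps class_ring_simps algebra_simps\<close>)

lemma inner_product_space_coord_space: "inner_product_space (coord_space m)"
proof -
  \<comment> \<open>Definiteness: the inner product kills the coordinates below \<open>m\<close>,
    membership in the carrier the others.\<close>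
  have "f = (\<lambda>_. 0)" if f: "\<forall>k\<ge>m. f k = 0" and 0: "(\<Sum>k<m. f k * cnj (f k)) = 0" for f :: "nat \<Rightarrow> complex"
  proof
    fix k
    have "complex_of_real (\<Sum>k<m. (cmod (f k))\<^sup>2) = 0"
      using 0 by (simp add: mult_cnj_cmod)
    then have "\<forall>k<m. (cmod (f k))\<^sup>2 = 0"
      unfolding of_real_eq_0_iff by (subst (asm) sum_nonneg_eq_0_iff) auto
    then show "f k = 0" using f by (cases "k < m") auto
  qed
  then show ?thesis
    unfolding inner_product_space_def
    by (auto simp: module_coord_space coord_space_simps distrib_left distrib_right sum.distrib sum_distrib_left
        mult.commute mult.left_commute mult_cnj_cmod intro!: sum_nonneg)
qed

lemma complete_coord_space: "complete_ip_space (coord_space m)"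
  unfolding complete_ip_space_def
proof (intro allI impI)
  fix f :: "nat \<Rightarrow> nat \<Rightarrow> complex"
  assume ran: "range f \<subseteq> carrier (coord_space m)"
    and cau: "\<forall>e>0. \<exists>M. \<forall>p\<ge>M. \<forall>q\<ge>M. ip_norm (coord_space m) (f p \<ominus>\<^bsub>coord_space m\<^esub> f q) < e"
  have f: "f p \<in> carrier (coord_space m)" for p using ran by auto
  have le: "cmod (f p k - f q k) \<le> ip_norm (coord_space m) (f p \<ominus>\<^bsub>coord_space m\<^esub> f q)" if "k < m" for p q k
    using member_le_L2_set[of "{..<m}" k "\<lambda>k. cmod (f p k - f q k)"] that
    by (simp add: coord_space_minus[OF f f] ip_norm_coord_space)
  have "Cauchy (\<lambda>p. f p k)" if "k < m" for k
    unfolding Cauchy_def dist_norm using cau le[OF that] by (meson le_less_trans)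
  then have "\<forall>k<m. \<exists>x. (\<lambda>p. f p k) \<longlonglongrightarrow> x"
    by (simp add: Cauchy_convergent_iff convergent_def)
  then obtain l where l: "\<And>k. k < m \<Longrightarrow> (\<lambda>p. f p k) \<longlonglongrightarrow> l k" by metis
  \<comment> \<open>The coordinatewise limits are extended by zero so that the limit stays in the
    carrier.\<close>
  define l' where "l' k = (if k < m then l k else 0)" for k
  have l': "l' \<in> carrier (coord_space m)" by (auto simp: l'_def coord_space_simps)
  have "(\<lambda>p. sqrt (\<Sum>k<m. (cmod (f p k - l' k))\<^sup>2)) \<longlonglongrightarrow> sqrt (\<Sum>k<m. (cmod (l k - l' k))\<^sup>2)"
    by (intro tendsto_intros l) auto
  then have "(\<lambda>p. ip_norm (coord_space m) (f p \<ominus>\<^bsub>coord_space m\<^esub> l')) \<longlonglongrightarrow> 0"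
    by (simp add: coord_space_minus[OF f l'] ip_norm_coord_space L2_set_def l'_def)
  with l' show "\<exists>l\<in>carrier (coord_space m). (\<lambda>p. ip_norm (coord_space m) (f p \<ominus>\<^bsub>coord_space m\<^esub> l)) \<longlonglongrightarrow> 0"
    by blast
qed

lemma hilbert_space_coord_space: "hilbert_space (coord_space m)"
  by (simp add: hilbert_space_def inner_product_space_coord_space complete_coord_space)

section \<open>Multiplication operators and their joint spectrum\<close>

definition mult_op :: "(nat \<Rightarrow> complex) \<Rightarrow> (nat \<Rightarrow> complex) \<Rightarrow> nat \<Rightarrow> complex" where
  "mult_op g f = (\<lambda>k. g k * f k)"

lemma bounded_op_mult_op: "bounded_op (coord_space m) (coord_space m) (mult_op g)"
proof -
  \<comment> \<open>The sum of the moduli serves as operator bound because it dominates each single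
    multiplier.\<close>
  have "ip_norm (coord_space m) (mult_op g f) \<le> (\<Sum>k<m. cmod (g k)) * ip_norm (coord_space m) f" for f
  proof -
    have "ip_norm (coord_space m) (mult_op g f) \<le> L2_set (\<lambda>k. (\<Sum>k<m. cmod (g k)) * cmod (f k)) {..<m}"
      unfolding ip_norm_coord_space
      by (intro L2_set_mono) (auto simp: mult_op_def norm_mult intro!: mult_right_mono member_le_sum)
    also have "\<dots> = (\<Sum>k<m. cmod (g k)) * ip_norm (coord_space m) f"
      by (simp add: ip_norm_coord_space L2_set_right_distrib sum_nonneg)
    finally show ?thesis .
  qed
  moreover have "linear_op (coord_space m) (coord_space m) (mult_op g)"
    unfolding linear_op_def by (auto simp: coord_space_simps mult_op_def algebra_simps)
  ultimately show ?thesis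
    unfolding bounded_op_def by blast
qed

lemma commuting_normal_mult_op: "commuting_normal_tuple (coord_space m) (\<lambda>i. mult_op (g i))"
proof -
  have "is_adjoint (coord_space m) (coord_space m) (mult_op h) (mult_op (\<lambda>k. cnj (h k)))" for h
    by (auto simp: is_adjoint_def bounded_op_mult_op coord_space_simps mult_op_def mult_ac)
  then show ?thesis
    unfolding commuting_normal_tuple_def normal_op_def
    by (intro conjI allI ballI bounded_op_mult_op exI) (auto simp: mult_op_def mult_ac)
qed

text \<open>If \<mu> differs from every point \<open>g k\<close> with \<open>k < m\<close>, the sum
  over i of |g_i(k) - \<mu>_i|^2 is nonzero for each such k. Dividing the conjugate differences by
  it gives bounded multiplication operators that, by commutativity, solve the left and the right
  equation at once.\<close>

lemma joint_spectrum_mult_op: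
  fixes g :: "'d::finite \<Rightarrow> nat \<Rightarrow> complex"
  shows "joint_spectrum (coord_space m) (\<lambda>i. mult_op (g i)) \<subseteq> (\<lambda>k. \<chi> i. g i k) ` {..<m}"
proof
  fix \<mu> assume \<mu>: "\<mu> \<in> joint_spectrum (coord_space m) (\<lambda>i. mult_op (g i))"
  show "\<mu> \<in> (\<lambda>k. \<chi> i. g i k) ` {..<m}"
  proof (rule ccontr)
    assume notin: "\<mu> \<notin> (\<lambda>k. \<chi> i. g i k) ` {..<m}"
    define s where "s k = (\<Sum>i\<in>UNIV. (g i k - \<mu> $ i) * cnj (g i k - \<mu> $ i))" for k
    have s: "s k \<noteq> 0" if "k < m" for k
    proof
      assume "s k = 0"
      then have "complex_of_real (\<Sum>i\<in>UNIV. (cmod (g i k - \<mu> $ i))\<^sup>2) = 0"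
        by (simp add: s_def mult_cnj_cmod del: complex_cnj_diff)
      then have "\<forall>i. (cmod (g i k - \<mu> $ i))\<^sup>2 = 0"
        unfolding of_real_eq_0_iff by (subst (asm) sum_nonneg_eq_0_iff) auto
      then have "\<mu> = (\<chi> i. g i k)" by (simp add: vec_eq_iff)
      with notin that show False by blast
    qed
    define B where "B i = mult_op (\<lambda>k. cnj (g i k - \<mu> $ i) / s k)" for i
    \<comment> \<open>From \<open>m\<close> on the divisor \<open>s k\<close> may vanish, but there
      \<open>x\<close> itself is zero.\<close>
    have inv: "(\<lambda>k. \<Sum>i\<in>UNIV. (g i k - \<mu> $ i) * cnj (g i k - \<mu> $ i) / s k * x k) = x"
      if "x \<in> carrier (coord_space m)" for x
    proof
      fix k
      show "(\<Sum>i\<in>UNIV. (g i k - \<mu> $ i) * cnj (g i k - \<mu> $ i) / s k * x k) = x k"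
      proof (cases "k < m")
        case True
        then show ?thesis using s[OF True]
          by (simp add: s_def del: complex_cnj_diff flip: sum_distrib_right sum_divide_distrib)
      next
        case False
        with that show ?thesis by (simp add: coord_space_simps)
      qed
    qed
    let ?L = "coord_space m"
    have mc: "mult_op h x \<in> carrier ?L" if "x \<in> carrier ?L" for h x
      using that by (auto simp: coord_space_simps mult_op_def)
    have sc: "c \<odot>\<^bsub>?L\<^esub> x \<in> carrier ?L" if "x \<in> carrier ?L" for c x
      using that by (auto simp: coord_space_simps)
    have d: "mult_op (g i) x \<ominus>\<^bsub>?L\<^esub> \<mu> $ i \<odot>\<^bsub>?L\<^esub> x = mult_op (\<lambda>k. g i k - \<mu> $ i) x"
      if "x \<in> carrier ?L" for i x
      using coord_space_minus[OF mc[OF that] sc[OF that]]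
      by (simp add: coord_space_simps mult_op_def left_diff_distrib)
    have bB: "\<forall>i. bounded_op ?L ?L (B i)" by (simp add: B_def bounded_op_mult_op)
    have "(\<Oplus>\<^bsub>?L\<^esub>i\<in>UNIV. B i (mult_op (g i) x \<ominus>\<^bsub>?L\<^esub> \<mu> $ i \<odot>\<^bsub>?L\<^esub> x)) = x"
      and "(\<Oplus>\<^bsub>?L\<^esub>i\<in>UNIV. mult_op (g i) (B i x) \<ominus>\<^bsub>?L\<^esub> \<mu> $ i \<odot>\<^bsub>?L\<^esub> B i x) = x"
      if "x \<in> carrier ?L" for x
      using that mc inv[OF that]
      by (simp_all add: d B_def coord_space_finsum Pi_def) (simp_all add: mult_op_def mult_ac)
    with bB \<mu> show False unfolding joint_spectrum_def by blast
  qed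
qed

section \<open>Diagonal dilations from rank one decompositions\<close>

lemma cn_space_simps:
  "carrier (cn_space n) = carrier_vec n"
  "x \<oplus>\<^bsub>cn_space n\<^esub> y = x + y"
  "c \<odot>\<^bsub>cn_space n\<^esub> x = c \<cdot>\<^sub>v x"
  "ip (cn_space n) x y = x \<bullet>c y"
  by (simp_all add: cn_space_def module_vec_def module.defs ip_space.defs)

lemma cscalar_prod_sum:
  fixes x y :: "complex Matrix.vec"
  assumes "x \<in> carrier_vec n" "y \<in> carrier_vec n"
  shows "x \<bullet>c y = (\<Sum>p<n. vec_index x p * cnj (vec_index y p))"
  using assms by (auto simp: scalar_prod_def lessThan_atLeast0 intro!: sum.cong)

lemma ip_norm_cn_space:
  assumes "x \<in> carrier_vec n"
  shows "ip_norm (cn_space n) x = L2_set (\<lambda>p. cmod (vec_index x p)) {..<n}"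
  by (simp add: ip_norm_def cn_space_simps cscalar_prod_sum[OF assms assms] L2_set_def mult_cnj_cmod
      flip: of_real_power of_real_sum)

text \<open>\<open>one\<close> says that the vectors w_k form a Parseval frame of C^n. Its analysis
  operator \<open>V\<close>, sending x to the sequence of inner products of x with w_k, is then an
  isometry with adjoint the synthesis operator \<open>V'\<close>. Compressing the diagonal operators
  with entries \<open>h k $ i\<close> by \<open>V\<close> gives the weighted sum of rank ones in
  \<open>sum\<close>, and their joint spectrum consists of points \<open>h k\<close>.\<close>

lemma Wmin_level_of_rank_ones:
  fixes X :: "'d::finite \<Rightarrow> complex mat" and h :: "nat \<Rightarrow> real ^ 'd"
  assumes X: "X \<in> sa_tuples n"
    and h: "\<And>k. k < m \<Longrightarrow> h k \<in> K"
    and one: "\<And>p q. p < n \<Longrightarrow> q < n \<Longrightarrow> (\<Sum>k<m. w k p * cnj (w k q)) = (if p = q then 1 else 0)"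
    and sum: "\<And>i p q. p < n \<Longrightarrow> q < n \<Longrightarrow>
      X i $$ (p, q) = (\<Sum>k<m. complex_of_real (h k $ i) * (w k p * cnj (w k q)))"
  shows "X \<in> Wmin_level n K"
proof -
  let ?L = "coord_space m"
  define N where "N i = mult_op (\<lambda>k. complex_of_real (h k $ i))" for i
  define V where "V x = (\<lambda>k. if k < m then \<Sum>p<n. vec_index x p * cnj (w k p) else 0)"
    for x :: "complex Matrix.vec"
  define V' where "V' f = Matrix.vec n (\<lambda>p. \<Sum>k<m. f k * w k p)" for f
  have V'c: "V' f \<in> carrier_vec n" for f by (simp add: V'_def)
  \<comment> \<open>The free weight \<open>c\<close> covers two uses: \<open>c = 1\<close> gives
    that \<open>V'\<close> inverts \<open>V\<close>, and \<open>c k = h k $ i\<close> gives the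
    compression.\<close>
  have V'V: "vec_index (V' (\<lambda>k. c k * V x k)) p = (\<Sum>q<n. (\<Sum>k<m. c k * (w k p * cnj (w k q))) * vec_index x q)"
    if "p < n" for c x p
  proof -
    have "vec_index (V' (\<lambda>k. c k * V x k)) p = (\<Sum>k<m. \<Sum>q<n. c k * (w k p * cnj (w k q)) * vec_index x q)"
      using that by (simp add: V'_def V_def sum_distrib_left sum_distrib_right mult_ac)
    also have "\<dots> = (\<Sum>q<n. (\<Sum>k<m. c k * (w k p * cnj (w k q))) * vec_index x q)"
      by (subst sum.swap) (simp add: sum_distrib_right)
    finally show ?thesis .
  qed
  have V'V1: "V' (V x) = x" if x: "x \<in> carrier_vec n" for x
  proof (rule eq_vecI)
    fix p assume "p < dim_vec x"
    then have p: "p < n" using x by auto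
    have "vec_index (V' (V x)) p = (\<Sum>q<n. (if p = q then 1 else 0) * vec_index x q)"
      using V'V[OF p, of "\<lambda>_. 1" x] p by (simp add: one)
    also have "\<dots> = (\<Sum>q<n. if p = q then vec_index x q else 0)"
      by (intro sum.cong) auto
    finally show "vec_index (V' (V x)) p = vec_index x p" using p by simp
  qed (use x in \<open>auto simp: V'_def\<close>)
  have adj: "ip ?L (V x) f = x \<bullet>c V' f" if x: "x \<in> carrier_vec n" for x f
  proof -
    have "ip ?L (V x) f = (\<Sum>k<m. \<Sum>p<n. vec_index x p * cnj (w k p) * cnj (f k))"
      by (simp add: coord_space_simps V_def sum_distrib_right)
    also have "\<dots> = x \<bullet>c V' f"
      unfolding cscalar_prod_sum[OF x V'c]
      by (subst sum.swap) (simp add: V'_def sum_distrib_left mult_ac)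
    finally show ?thesis .
  qed
  have V: "V x \<in> carrier ?L" for x by (simp add: V_def coord_space_simps)
  have iso: "isometry_op (cn_space n) ?L V"
    unfolding isometry_op_def linear_op_def cn_space_simps
  proof (intro conjI ballI allI)
    fix x :: "complex Matrix.vec" assume x: "x \<in> carrier_vec n"
    \<comment> \<open>Moving \<open>V\<close> across the inner product by \<open>adj\<close> reduces
      this to \<open>V' (V x) = x\<close>.\<close>
    show "ip_norm ?L (V x) = ip_norm (cn_space n) x"
      by (simp add: ip_norm_def adj[OF x] V'V1[OF x] cn_space_simps)
    fix c show "V (c \<cdot>\<^sub>v x) = c \<odot>\<^bsub>?L\<^esub> V x"
      using x by (auto simp: V_def coord_space_simps sum_distrib_left mult_ac)
    fix y :: "complex Matrix.vec" assume "y \<in> carrier_vec n"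
    then show "V (x + y) = V x \<oplus>\<^bsub>?L\<^esub> V y"
      using x by (auto simp: V_def coord_space_simps sum.distrib distrib_right)
  qed (use V in auto)
  \<comment> \<open>A crude bound suffices: the Euclidean norm is at most the sum of the moduli, and
    each coordinate of \<open>f\<close> is at most its norm.\<close>
  have bd: "ip_norm (cn_space n) (V' f) \<le> (\<Sum>p<n. \<Sum>k<m. cmod (w k p)) * ip_norm ?L f" for f
  proof -
    have "ip_norm (cn_space n) (V' f) \<le> (\<Sum>p<n. cmod (vec_index (V' f) p))"
      unfolding ip_norm_cn_space[OF V'c] by (rule L2_set_le_sum) simp
    also have "\<dots> \<le> (\<Sum>p<n. \<Sum>k<m. cmod (w k p) * ip_norm ?L f)"
    proof (intro sum_mono)
      fix p assume p: "p \<in> {..<n}"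
      then have "cmod (vec_index (V' f) p) \<le> (\<Sum>k<m. cmod (f k * w k p))"
        by (simp add: V'_def norm_sum)
      also have "\<dots> \<le> (\<Sum>k<m. cmod (w k p) * ip_norm ?L f)"
        unfolding ip_norm_coord_space norm_mult mult.commute[of "cmod (w _ _)"]
        using member_le_L2_set[of "{..<m}" _ "\<lambda>k. cmod (f k)"]
        by (intro sum_mono mult_right_mono) auto
      finally show "cmod (vec_index (V' f) p) \<le> (\<Sum>k<m. cmod (w k p) * ip_norm ?L f)" .
    qed
    finally show ?thesis by (simp add: sum_distrib_right)
  qed
  have "linear_op ?L (cn_space n) V'"
    unfolding linear_op_def cn_space_simps using V'c
    by (auto simp: V'_def coord_space_simps sum.distrib distrib_left distrib_right
        sum_distrib_left mult_ac intro!: eq_vecI)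
  with bd have "bounded_op ?L (cn_space n) V'"
    unfolding bounded_op_def by blast
  then have isadj: "is_adjoint (cn_space n) ?L V V'"
    by (simp add: is_adjoint_def cn_space_simps adj)
  have "joint_spectrum ?L N \<subseteq> complex_points K"
  proof -
    have "joint_spectrum ?L N \<subseteq> (\<lambda>k. \<chi> i. complex_of_real (h k $ i)) ` {..<m}"
      unfolding N_def by (rule joint_spectrum_mult_op)
    also have "\<dots> \<subseteq> complex_points K"
      using h by (auto simp: complex_points_def)
    finally show ?thesis .
  qed
  moreover have "X i *\<^sub>v x = V' (N i (V x))" if x: "x \<in> carrier_vec n" for i x
  proof (rule eq_vecI)
    have Xi: "X i \<in> carrier_mat n n" using X by (simp add: sa_tuples_def)
    show "dim_vec (X i *\<^sub>v x) = dim_vec (V' (N i (V x)))"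
      using Xi by (simp add: V'_def)
    fix p assume "p < dim_vec (V' (N i (V x)))"
    then have p: "p < n" by (simp add: V'_def)
    have "vec_index (X i *\<^sub>v x) p = (\<Sum>q<n. X i $$ (p, q) * vec_index x q)"
      using Xi x p by (auto simp: scalar_prod_def lessThan_atLeast0 intro!: sum.cong)
    also have "\<dots> = vec_index (V' (N i (V x))) p"
      using V'V[OF p, of "\<lambda>k. complex_of_real (h k $ i)" x] p
      by (simp add: sum N_def mult_op_def)
    finally show "vec_index (X i *\<^sub>v x) p = vec_index (V' (N i (V x))) p" .
  qed
  ultimately show ?thesis
    unfolding Wmin_level_def using X iso isadj hilbert_space_coord_space
      commuting_normal_mult_op[of m "\<lambda>i k. complex_of_real (h k $ i)", folded N_def]
    by blast
qed

text \<open>Enumerating \<open>I\<close> reduces this to indices below a number. The freedom in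
  \<open>I\<close> allows rank ones indexed by triples of a frame vector, an endpoint and a
  summand.\<close>

lemma Wmin_level_of_finite_rank_ones:
  fixes X :: "'d::finite \<Rightarrow> complex mat" and h :: "'k \<Rightarrow> real ^ 'd"
  assumes X: "X \<in> sa_tuples n" and I: "finite I"
    and h: "\<And>k. k \<in> I \<Longrightarrow> h k \<in> K"
    and one: "\<And>p q. p < n \<Longrightarrow> q < n \<Longrightarrow> (\<Sum>k\<in>I. w k p * cnj (w k q)) = (if p = q then 1 else 0)"
    and sum: "\<And>i p q. p < n \<Longrightarrow> q < n \<Longrightarrow>
      X i $$ (p, q) = (\<Sum>k\<in>I. complex_of_real (h k $ i) * (w k p * cnj (w k q)))"
  shows "X \<in> Wmin_level n K"
proof -
  obtain e where e: "bij_betw e {..<card I} I"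
    using ex_bij_betw_nat_finite[OF I] by (auto simp: atLeast0LessThan)
  note r = sum.reindex_bij_betw[OF e]
  show ?thesis
  proof (rule Wmin_level_of_rank_ones[OF X, where m = "card I" and h = "h \<circ> e" and w = "w \<circ> e"])
    show "(h \<circ> e) k \<in> K" if "k < card I" for k
      using h bij_betwE[OF e] that by auto
  qed (simp_all add: one sum r[of "\<lambda>k. w k _ * cnj (w k _)"]
      r[of "\<lambda>k. complex_of_real (h k $ _) * (w k _ * cnj (w k _))"])
qed

section \<open>Positive semidefinite kernels\<close>

text \<open>Kernels on arbitrary index sets stand in for matrices so that an induction can remove
  one index at a time without renumbering.\<close>

definition psd_on :: "'i set \<Rightarrow> ('i \<Rightarrow> 'i \<Rightarrow> complex) \<Rightarrow> bool" where
  "psd_on S a \<longleftrightarrow> (\<forall>p\<in>S. \<forall>q\<in>S. a q p = cnj (a p q)) \<and>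
     (\<forall>x. 0 \<le> Re (\<Sum>p\<in>S. \<Sum>q\<in>S. a p q * x q * cnj (x p)))"

lemma psd_onD:
  assumes "psd_on S a"
  shows "p \<in> S \<Longrightarrow> q \<in> S \<Longrightarrow> a q p = cnj (a p q)"
    and "0 \<le> Re (\<Sum>p\<in>S. \<Sum>q\<in>S. a p q * x q * cnj (x p))"
  using assms unfolding psd_on_def by blast+

text \<open>Principal submatrices inherit positivity, since a test vector on \<open>T\<close>
  extends by zero to \<open>S\<close>.\<close>

lemma psd_on_subset:
  assumes "finite S" "T \<subseteq> S" "psd_on S a"
  shows "psd_on T a"
  unfolding psd_on_def
proof (intro conjI allI)
  show "\<forall>p\<in>T. \<forall>q\<in>T. a q p = cnj (a p q)"
    using assms unfolding psd_on_def by blast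
  fix x :: "'a \<Rightarrow> complex"
  let ?y = "\<lambda>p. if p \<in> T then x p else 0"
  have "(\<Sum>p\<in>T. \<Sum>q\<in>T. a p q * x q * cnj (x p)) = (\<Sum>p\<in>T. \<Sum>q\<in>T. a p q * ?y q * cnj (?y p))"
    by (intro sum.cong) auto
  also have "\<dots> = (\<Sum>p\<in>T. \<Sum>q\<in>S. a p q * ?y q * cnj (?y p))"
    using assms(1,2) by (intro sum.cong refl sum.mono_neutral_left) auto
  also have "\<dots> = (\<Sum>p\<in>S. \<Sum>q\<in>S. a p q * ?y q * cnj (?y p))"
    using assms(1,2) by (intro sum.mono_neutral_left) auto
  finally show "0 \<le> Re (\<Sum>p\<in>T. \<Sum>q\<in>T. a p q * x q * cnj (x p))"
    using psd_onD(2)[OF assms(3), of ?y] by simp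
qed

lemma sum_sum_insert:
  fixes f :: "'a \<Rightarrow> 'a \<Rightarrow> 'b::comm_monoid_add"
  assumes "finite S" "s \<notin> S"
  shows "(\<Sum>p\<in>insert s S. \<Sum>q\<in>insert s S. f p q) =
    f s s + (\<Sum>q\<in>S. f s q) + (\<Sum>p\<in>S. f p s) + (\<Sum>p\<in>S. \<Sum>q\<in>S. f p q)"
  using assms by (simp add: sum.distrib ac_simps)

lemma psd_on_diag:
  assumes "finite S" "psd_on S a" "s \<in> S"
  shows "a s s = complex_of_real (Re (a s s))" "0 \<le> Re (a s s)"
proof -
  have "psd_on {s} a" using psd_on_subset assms by blast
  then have "a s s = cnj (a s s)" "\<forall>x. 0 \<le> Re (a s s * x s * cnj (x s))"
    unfolding psd_on_def by simp_all
  from this(1) this(2)[rule_format, of "\<lambda>_. 1"]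
  show "a s s = complex_of_real (Re (a s s))" "0 \<le> Re (a s s)"
    by (simp_all add: complex_eq_iff)
qed

text \<open>On the indices p and s the test vector (1, -t cnj(a p s)) gives the value a p p - 2 t |a
  p s|^2, which becomes negative for large t unless \<open>a p s\<close> vanishes.\<close>

lemma psd_on_zero_diag:
  assumes "finite S" "psd_on S a" "s \<in> S" "p \<in> S" "a s s = 0"
  shows "a p s = 0"
proof (cases "p = s")
  case False
  have psd: "psd_on {p, s} a" using psd_on_subset[OF assms(1) _ assms(2)] assms(3,4) by simp
  have h: "a s p = cnj (a p s)" using psd unfolding psd_on_def by blast
  have *: "0 \<le> Re (a p p) - 2 * t * (cmod (a p s))\<^sup>2" for t :: real
  proof -
    define y where "y = - of_real t * cnj (a p s)"
    let ?x = "\<lambda>j. if j = p then 1 else y"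
    have "0 \<le> Re (\<Sum>i\<in>{p,s}. \<Sum>j\<in>{p,s}. a i j * ?x j * cnj (?x i))"
      by (rule psd_onD(2)[OF psd])
    also have "(\<Sum>i\<in>{p,s}. \<Sum>j\<in>{p,s}. a i j * ?x j * cnj (?x i)) = a p p + a p s * y + cnj (a p s * y)"
      using False assms(5) h by simp
    also have "a p s * y = - of_real (t * (cmod (a p s))\<^sup>2)"
      unfolding y_def by (simp add: complex_norm_square del: of_real_power)
    finally show ?thesis by simp
  qed
  show ?thesis
  proof (rule ccontr)
    assume "a p s \<noteq> 0"
    then have "(cmod (a p s))\<^sup>2 > 0" by simp
    \<comment> \<open>This t makes the right-hand side of \<open>*\<close> equal to -1.\<close>
    with *[of "(Re (a p p) + 1) / (2 * (cmod (a p s))\<^sup>2)"] show False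
      by (simp add: field_simps)
  qed
qed (use assms in auto)

text \<open>Cholesky factorisation: the induction step splits off the Schur complement of one diagonal entry.\<close>

lemma psd_on_sum_rank_one:
  assumes "finite S" "psd_on S a"
  shows "\<exists>w. \<forall>p\<in>S. \<forall>q\<in>S. a p q = (\<Sum>k\<in>S. w k p * cnj (w k q))"
  using assms
proof (induction S arbitrary: a rule: finite_induct)
  case (insert s S)
  let ?T = "insert s S"
  note psd = \<open>psd_on ?T a\<close>
  have fin: "finite ?T" using insert.hyps by simp
  have herm: "a q p = cnj (a p q)" if "p \<in> ?T" "q \<in> ?T" for p q
    by (rule psd_onD(1)[OF psd that])
  show ?case
  proof (cases "a s s = 0")
    case True
    have "psd_on S a" using psd fin psd_on_subset by blast
    then obtain w where w: "\<forall>p\<in>S. \<forall>q\<in>S. a p q = (\<Sum>k\<in>S. w k p * cnj (w k q))"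
      using insert.IH by blast
    \<comment> \<open>A zero diagonal entry kills its row and column, so a factorisation over
      \<open>S\<close> extends by zero.\<close>
    have z: "a p s = 0" "a s p = 0" if "p \<in> ?T" for p
      using psd_on_zero_diag[OF fin psd _ that True] herm[of p s] that by auto
    let ?w = "\<lambda>k p. if k = s \<or> p = s then 0 else w k p"
    have "a p q = (\<Sum>k\<in>?T. ?w k p * cnj (?w k q))" if "p \<in> ?T" "q \<in> ?T" for p q
    proof (cases "p = s \<or> q = s")
      case True
      then show ?thesis using z that by (auto intro!: sum.neutral[symmetric])
    next
      case False
      then have "(\<Sum>k\<in>?T. ?w k p * cnj (?w k q)) = (\<Sum>k\<in>S. w k p * cnj (w k q))"
        using insert.hyps by (auto intro!: sum.cong)
      then show ?thesis using False that w by auto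
    qed
    then show ?thesis by (intro exI[of _ ?w]) blast
  next
    case False
    define r where "r = Re (a s s)"
    have ass: "a s s = of_real r" and r: "r > 0"
      using psd_on_diag[OF fin psd, of s] False unfolding r_def
      by (auto simp: less_le)
    define b where "b p q = a p q - a p s * a s q / of_real r" for p q
    have "psd_on S b"
      unfolding psd_on_def
    proof (intro conjI allI ballI)
      fix p q assume "p \<in> S" "q \<in> S"
      then show "b q p = cnj (b p q)"
        using herm[of p q] herm[of p s] herm[of s q] by (simp add: b_def)
    next
      fix x :: "'a \<Rightarrow> complex"
      define c where "c = (\<Sum>q\<in>S. a s q * x q)"
      have cc: "(\<Sum>p\<in>S. a p s * cnj (x p)) = cnj c"
        unfolding c_def cnj_sum by (intro sum.cong refl) (simp add: herm[of _ s])
      \<comment> \<open>The value at \<open>s\<close> minimises the form of \<open>a\<close> for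
        fixed \<open>x\<close> on \<open>S\<close>; the minimum, found by completing the square, is
        the form of the Schur complement \<open>b\<close> at \<open>x\<close>.\<close>
      define y where "y = x(s := - c / of_real r)"
      have yS: "y p = x p" if "p \<in> S" for p using that insert.hyps by (auto simp: y_def)
      have ys: "y s = - c / of_real r" by (simp add: y_def)
      have "(\<Sum>p\<in>?T. \<Sum>q\<in>?T. a p q * y q * cnj (y p)) =
          a s s * y s * cnj (y s) + (\<Sum>q\<in>S. a s q * x q) * cnj (y s)
          + (\<Sum>p\<in>S. a p s * cnj (x p)) * y s + (\<Sum>p\<in>S. \<Sum>q\<in>S. a p q * x q * cnj (x p))"
        using insert.hyps by (simp add: sum_sum_insert sum_distrib_left sum_distrib_right yS mult_ac)
      also have "\<dots> = (\<Sum>p\<in>S. \<Sum>q\<in>S. a p q * x q * cnj (x p)) - c * cnj c / of_real r"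
        using r by (simp add: ass ys cc flip: c_def)
      also have "c * cnj c / of_real r = (\<Sum>p\<in>S. \<Sum>q\<in>S. a p s * a s q / of_real r * x q * cnj (x p))"
        unfolding mult.commute[of c] cc[symmetric] unfolding c_def
        by (simp only: sum_product sum_divide_distrib) (simp add: mult_ac)
      also have "(\<Sum>p\<in>S. \<Sum>q\<in>S. a p q * x q * cnj (x p)) - \<dots> = (\<Sum>p\<in>S. \<Sum>q\<in>S. b p q * x q * cnj (x p))"
        by (simp add: b_def sum_subtractf left_diff_distrib)
      finally show "0 \<le> Re (\<Sum>p\<in>S. \<Sum>q\<in>S. b p q * x q * cnj (x p))"
        using psd_onD(2)[OF psd, of y] by simp
    qed
    then obtain w where w: "\<forall>p\<in>S. \<forall>q\<in>S. b p q = (\<Sum>k\<in>S. w k p * cnj (w k q))"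
      using insert.IH by blast
    \<comment> \<open>The new rank one term is the column of \<open>s\<close> divided by the root of
      the pivot, so it reproduces exactly what \<open>b\<close> subtracts. The old terms are reset
      to zero at \<open>s\<close>, where the induction hypothesis says nothing.\<close>
    let ?w = "\<lambda>k p. if k = s then a p s / of_real (sqrt r) else if p = s then 0 else w k p"
    have sq: "complex_of_real (sqrt r) * of_real (sqrt r) = of_real r"
      using r by (simp flip: of_real_mult)
    have "a p q = (\<Sum>k\<in>?T. ?w k p * cnj (?w k q))" if "p \<in> ?T" "q \<in> ?T" for p q
    proof -
      have "(\<Sum>k\<in>?T. ?w k p * cnj (?w k q)) =
          a p s * a s q / of_real r + (\<Sum>k\<in>S. ?w k p * cnj (?w k q))"
        using insert.hyps herm[of q s] that by (simp add: sq)
      also have "(\<Sum>k\<in>S. ?w k p * cnj (?w k q)) = (if p = s \<or> q = s then 0 else \<Sum>k\<in>S. w k p * cnj (w k q))"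
        using insert.hyps by (auto intro!: sum.cong sum.neutral)
      also have "\<dots> = (if p = s \<or> q = s then 0 else b p q)"
        using w that by auto
      finally show ?thesis using r by (auto simp: b_def ass)
    qed
    then show ?thesis by (intro exI[of _ ?w]) blast
  qed
qed auto

lemma psd_on_cong:
  assumes "\<And>p q. p \<in> S \<Longrightarrow> q \<in> S \<Longrightarrow> a p q = b p q"
  shows "psd_on S a \<longleftrightarrow> psd_on S b"
proof -
  have "(\<Sum>p\<in>S. \<Sum>q\<in>S. a p q * x q * cnj (x p)) = (\<Sum>p\<in>S. \<Sum>q\<in>S. b p q * x q * cnj (x p))" for x
    by (intro sum.cong refl) (simp add: assms)
  moreover have "(\<forall>p\<in>S. \<forall>q\<in>S. a q p = cnj (a p q)) \<longleftrightarrow> (\<forall>p\<in>S. \<forall>q\<in>S. b q p = cnj (b p q))"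
    by (intro ball_cong refl) (simp add: assms)
  ultimately show ?thesis by (simp only: psd_on_def)
qed

text \<open>Both signs force a zero diagonal, and a zero diagonal entry kills its column. This
  settles the degenerate case of equal bounds below.\<close>

lemma psd_on_antisym:
  assumes "finite S" "psd_on S a" "psd_on S (\<lambda>p q. - a p q)" "p \<in> S" "q \<in> S"
  shows "a p q = 0"
proof -
  have "a q q = 0"
    using psd_on_diag[OF assms(1,2,5)] psd_on_diag[OF assms(1,3,5)] by (simp add: complex_eq_iff)
  then show ?thesis using psd_on_zero_diag[OF assms(1,2,5,4)] by simp
qed

text \<open>The kernels (A - lo I) / (hi - lo) and (hi I - A) / (hi - lo) are positive, sum to I,
  and weighted by \<open>hi\<close> and \<open>lo\<close> sum to A. Each is then split into rank
  ones; the Boolean \<open>b\<close> selects the endpoint.\<close>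

lemma rank_ones_between:
  fixes A :: "'i \<Rightarrow> 'i \<Rightarrow> complex" and lo hi :: real
  assumes S: "finite S" and le: "lo \<le> hi"
    and lo: "psd_on S (\<lambda>p q. A p q - (if p = q then of_real lo else 0))"
    and hi: "psd_on S (\<lambda>p q. (if p = q then of_real hi else 0) - A p q)"
  shows "\<exists>w. \<forall>p\<in>S. \<forall>q\<in>S.
    (\<Sum>b\<in>UNIV. \<Sum>k\<in>S. w b k p * cnj (w b k q)) = (if p = q then 1 else 0) \<and>
    (\<Sum>b\<in>UNIV. \<Sum>k\<in>S. of_real (if b then hi else lo) * (w b k p * cnj (w b k q))) = A p q"
proof (cases "lo = hi")
  case True
  have A: "A p q = (if p = q then of_real lo else 0)" if "p \<in> S" "q \<in> S" for p q
    using psd_on_antisym[OF S lo _ that] hi True by (simp only: minus_diff_eq) simp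
  \<comment> \<open>Here A is the multiple \<open>lo\<close> of the identity, so the standard basis,
    attached to one endpoint only, is enough.\<close>
  define w :: "bool \<Rightarrow> 'i \<Rightarrow> 'i \<Rightarrow> complex" where "w b k p = (if b \<and> k = p then 1 else 0)" for b k p
  have "(\<Sum>k\<in>S. w b k p * cnj (w b k q)) = (if b \<and> p = q then 1 else 0)" if "p \<in> S" "q \<in> S" for b p q
  proof -
    have "(\<Sum>k\<in>S. w b k p * cnj (w b k q)) = (\<Sum>k\<in>S. if k = p then (if b \<and> p = q then 1 else 0) else 0)"
      by (intro sum.cong) (auto simp: w_def)
    then show ?thesis using that S by simp
  qed
  then show ?thesis
    using A True by (intro exI[of _ w]) (simp add: UNIV_bool flip: sum_distrib_left)
next
  case False
  with le have lt: "hi - lo > 0" by simp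
  obtain u where u: "\<forall>p\<in>S. \<forall>q\<in>S. A p q - (if p = q then of_real lo else 0) =
      (\<Sum>k\<in>S. u k p * cnj (u k q))"
    using psd_on_sum_rank_one[OF S lo] ..
  obtain u' where u': "\<forall>p\<in>S. \<forall>q\<in>S. (if p = q then of_real hi else 0) - A p q =
      (\<Sum>k\<in>S. u' k p * cnj (u' k q))"
    using psd_on_sum_rank_one[OF S hi] ..
  \<comment> \<open>A real square root: dividing each vector by \<open>s\<close> divides its rank
    one kernel by \<open>hi - lo\<close>.\<close>
  define s where "s = complex_of_real (sqrt (hi - lo))"
  have s: "s * s = of_real hi - of_real lo" using lt by (simp add: s_def flip: of_real_mult)
  have s0: "complex_of_real hi - of_real lo \<noteq> 0" using lt by simp
  define w where "w b k p = (if b then u k p else u' k p) / s" for b k p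
  have w: "(\<Sum>k\<in>S. w b k p * cnj (w b k q)) =
      (if b then A p q - (if p = q then of_real lo else 0) else (if p = q then of_real hi else 0) - A p q)
        / (of_real hi - of_real lo)" if "p \<in> S" "q \<in> S" for b p q
  proof -
    have "(\<Sum>k\<in>S. w b k p * cnj (w b k q)) =
        (\<Sum>k\<in>S. (if b then u k p * cnj (u k q) else u' k p * cnj (u' k q))) / (of_real hi - of_real lo)"
      unfolding sum_divide_distrib by (intro sum.cong) (auto simp: w_def s[symmetric] s_def)
    then show ?thesis
      using u[rule_format, OF that, symmetric] u'[rule_format, OF that, symmetric]
      by (cases b) simp_all
  qed
  let ?D = "complex_of_real hi - of_real lo"
  show ?thesis
  proof (intro exI[of _ w] ballI conjI)
    fix p q assume pq: "p \<in> S" "q \<in> S"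
    have "(\<Sum>b\<in>UNIV. \<Sum>k\<in>S. w b k p * cnj (w b k q)) =
        ((A p q - (if p = q then of_real lo else 0)) + ((if p = q then of_real hi else 0) - A p q)) / ?D"
      by (simp only: UNIV_bool w[OF pq] add_divide_distrib) simp
    also have "\<dots> = (if p = q then 1 else 0)"
      using s0 by (cases "p = q") simp_all
    finally show "(\<Sum>b\<in>UNIV. \<Sum>k\<in>S. w b k p * cnj (w b k q)) = (if p = q then 1 else 0)" .
    have "(\<Sum>b\<in>UNIV. \<Sum>k\<in>S. of_real (if b then hi else lo) * (w b k p * cnj (w b k q))) =
        (of_real hi * (A p q - (if p = q then of_real lo else 0)) +
          of_real lo * ((if p = q then of_real hi else 0) - A p q)) / ?D"
      by (simp only: UNIV_bool sum_distrib_left[symmetric] w[OF pq] add_divide_distrib) simp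
    also have "\<dots> = A p q * ?D / ?D"
      by (cases "p = q") (simp_all add: algebra_simps)
    finally show "(\<Sum>b\<in>UNIV. \<Sum>k\<in>S. of_real (if b then hi else lo) * (w b k p * cnj (w b k q))) = A p q"
      using s0 by simp
  qed
qed

section \<open>From matrices and the maximal set to kernels\<close>

lemma mat_adjoint_index:
  fixes A :: "complex mat"
  assumes "i < dim_col A" "j < dim_row A"
  shows "mat_adjoint A $$ (i, j) = cnj (A $$ (j, i))"
  using assms by (simp add: mat_adjoint_def mat_of_rows_def)

lemma dim_mat_adjoint: "dim_row (mat_adjoint A) = dim_col A" "dim_col (mat_adjoint A) = dim_row A"
  by (simp_all add: mat_adjoint_def)

lemma psd_mat_imp_psd_on:
  assumes "psd_mat n A"
  shows "psd_on {..<n} (\<lambda>p q. A $$ (p, q))"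
  unfolding psd_on_def
proof (intro conjI ballI allI)
  have A: "A \<in> carrier_mat n n" and adj: "mat_adjoint A = A"
    and nn: "\<And>x. x \<in> carrier_vec n \<Longrightarrow> 0 \<le> Re ((A *\<^sub>v x) \<bullet>c x)"
    using assms by (auto simp: psd_mat_def)
  show "A $$ (q, p) = cnj (A $$ (p, q))" if "p \<in> {..<n}" "q \<in> {..<n}" for p q
    using mat_adjoint_index[of q A p] A that by (simp add: adj)
  fix x :: "nat \<Rightarrow> complex"
  let ?x = "Matrix.vec n x"
  have "(A *\<^sub>v ?x) \<bullet>c ?x = (\<Sum>p<n. \<Sum>q<n. A $$ (p, q) * x q * cnj (x p))"
    using A by (subst cscalar_prod_sum[of _ n])
      (auto simp: scalar_prod_def sum_distrib_right lessThan_atLeast0 intro!: sum.cong)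
  then show "0 \<le> Re (\<Sum>p<n. \<Sum>q<n. A $$ (p, q) * x q * cnj (x p))"
    using nn[of ?x] by simp
qed

text \<open>Applied to a frame vector and to its negative, this bounds the associated linear
  combination of the X_i from above and below.\<close>

lemma Wmax_level_psd_on:
  assumes X: "X \<in> Wmax_level n K" and a: "\<And>x. x \<in> K \<Longrightarrow> inner \<alpha> x \<le> a"
  shows "psd_on {..<n} (\<lambda>p q. (if p = q then of_real a else 0) -
    (\<Sum>i\<in>UNIV. complex_of_real (\<alpha> $ i) * X i $$ (p, q)))"
proof -
  let ?B = "complex_of_real a \<cdot>\<^sub>m 1\<^sub>m n - lin_comb_mat n \<alpha> X"
  have "psd_mat n ?B"
    using X a by (simp add: Wmax_level_def loewner_le_def inner_vec_def)
  then have "psd_on {..<n} (\<lambda>p q. ?B $$ (p, q))" by (rule psd_mat_imp_psd_on)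
  also have "psd_on {..<n} (\<lambda>p q. ?B $$ (p, q)) \<longleftrightarrow> ?thesis"
    by (intro psd_on_cong) (simp add: lin_comb_mat_def)
  finally show ?thesis .
qed

lemma sa_tuples_scale:
  assumes "X \<in> sa_tuples n"
  shows "(\<lambda>i. complex_of_real c \<cdot>\<^sub>m X i) \<in> sa_tuples n"
proof -
  have X: "X i \<in> carrier_mat n n" "mat_adjoint (X i) = X i" for i
    using assms by (auto simp: sa_tuples_def)
  have "mat_adjoint (complex_of_real c \<cdot>\<^sub>m X i) = complex_of_real c \<cdot>\<^sub>m X i" for i
  proof (rule eq_matI)
    fix p q assume "p < dim_row (complex_of_real c \<cdot>\<^sub>m X i)" "q < dim_col (complex_of_real c \<cdot>\<^sub>m X i)"
    then show "mat_adjoint (complex_of_real c \<cdot>\<^sub>m X i) $$ (p, q) = (complex_of_real c \<cdot>\<^sub>m X i) $$ (p, q)"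
      using X[of i] mat_adjoint_index[of p "X i" q] by (simp add: mat_adjoint_index)
  qed (use X[of i] in \<open>simp_all add: dim_mat_adjoint\<close>)
  then show ?thesis using X by (simp add: sa_tuples_def)
qed

section \<open>Frames\<close>

text \<open>The frame identity equates two quadratic forms; by polarisation, evaluating it at e_i
  and at e_i + e_j determines all entries of the frame operator.\<close>

lemma frame_matrix:
  fixes \<Phi> :: "(real ^ 'd) set"
  assumes \<sigma>: "\<And>x. (\<Sum>v\<in>\<Phi>. \<bar>inner x v\<bar>\<^sup>2) = \<sigma> * (norm x)\<^sup>2"
  shows "(\<Sum>v\<in>\<Phi>. v $ i * v $ j) = (if i = j then \<sigma> else 0)"
proof -
  have diag: "(\<Sum>v\<in>\<Phi>. (v $ i)\<^sup>2) = \<sigma>" for i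
    using \<sigma>[of "axis i 1"] by (simp add: inner_axis')
  show ?thesis
  proof (cases "i = j")
    case True
    then show ?thesis using diag[of i] by (simp add: power2_eq_square)
  next
    case False
    have "(norm (axis i 1 + axis j 1 :: real ^ 'd))\<^sup>2 = 2"
      using False by (simp add: power2_norm_eq_inner inner_add_left inner_add_right inner_axis_axis)
    then have "2 * \<sigma> = (\<Sum>v\<in>\<Phi>. (v $ i + v $ j)\<^sup>2)"
      using \<sigma>[of "axis i 1 + axis j 1"] by (simp add: inner_add_left inner_axis')
    also have "\<dots> = (\<Sum>v\<in>\<Phi>. (v $ i)\<^sup>2) + 2 * (\<Sum>v\<in>\<Phi>. v $ i * v $ j) + (\<Sum>v\<in>\<Phi>. (v $ j)\<^sup>2)"
      by (simp add: power2_sum sum.distrib sum_distrib_left mult_ac)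
    finally show ?thesis using False by (simp add: diag)
  qed
qed

text \<open>The orbit of \<open>x\<close> under the stabiliser of \<open>v\<close> averages to the orthogonal projection of \<open>x\<close> onto \<open>v\<close>.\<close>

lemma vertex_reflexive_projection:
  fixes \<Phi> :: "(real ^ 'd) set"
  assumes fin: "finite \<Phi>" and vr: "vertex_reflexive \<Phi>" and v: "v \<in> \<Phi>" "v \<noteq> 0" and x: "x \<in> \<Phi>"
  shows "(inner v x / (norm v)\<^sup>2) *\<^sub>R v \<in> convex hull \<Phi>"
proof -
  define G where "G = frame_Stab \<Phi> v"
  define orb where "orb = (\<lambda>U. U x) ` G"
  have G: "orthogonal_transformation U" "U ` \<Phi> = \<Phi>" "U v = v" if "U \<in> G" for U
    using that by (auto simp: G_def frame_Stab_def frame_Sym_def)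
  have sub: "orb \<subseteq> \<Phi>" using G(2) x by (auto simp: orb_def)
  then have finO: "finite orb" using fin finite_subset by blast
  have "id \<in> G"
    by (simp add: G_def frame_Stab_def frame_Sym_def orthogonal_transformation_def linear_id id_def[symmetric])
  then have "orb \<noteq> {}" by (auto simp: orb_def)
  with finO have card: "real (card orb) > 0" by (simp add: card_gt_0_iff)
  \<comment> \<open>The average runs over the points of the orbit, not over the group, so finiteness
    comes directly from \<Phi>. The orbit is nonempty because it contains \<open>x\<close>.\<close>
  define c where "c = (\<Sum>y\<in>orb. (1 / card orb) *\<^sub>R y)"
  have cK: "c \<in> convex hull \<Phi>"
    unfolding c_def using finO card sub
    by (intro convex_sum) (auto intro: hull_inc)
  \<comment> \<open>Elements of the stabiliser preserve inner products and fix
    \<open>v\<close>.\<close>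
  have inner_orb: "inner v y = inner v x" if "y \<in> orb" for y
  proof -
    from that obtain U where U: "U \<in> G" "y = U x" by (auto simp: orb_def)
    then show ?thesis using G(1,3)[OF U(1)] unfolding orthogonal_transformation_def by metis
  qed
  have ic: "inner v c = inner v x"
    using card by (simp add: c_def inner_sum_right inner_orb)
  have "U c = c" if U: "U \<in> G" for U
  proof -
    have lin: "linear U" and inj: "inj U"
      using G(1)[OF U] by (auto simp: orthogonal_transformation_linear orthogonal_transformation_inj)
    have "U ` orb \<subseteq> orb"
    proof
      fix z assume "z \<in> U ` orb"
      then obtain W where W: "W \<in> G" "z = (U \<circ> W) x" by (auto simp: orb_def)
      have "U \<circ> W \<in> G"
        using U W(1) by (auto simp: G_def frame_Stab_def frame_Sym_def orthogonal_transformation_compose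
          simp flip: image_image)
      with W(2) show "z \<in> orb" unfolding orb_def by blast
    qed
    \<comment> \<open>An injective self-map of a finite set is onto, so \<open>U\<close> permutes
      the orbit and therefore fixes its average.\<close>
    then have "U ` orb = orb"
      using finO inj by (intro endo_inj_surj) (auto intro: inj_on_subset)
    then have "bij_betw U orb orb" using inj by (auto simp: bij_betw_def intro: inj_on_subset)
    then show ?thesis
      using sum.reindex_bij_betw[of U orb orb "\<lambda>y. (1 / card orb) *\<^sub>R y"]
      by (simp add: c_def linear_sum[OF lin] linear_cmul[OF lin])
  qed
  then have "c \<in> span {v}"
    using vr v(1) by (auto simp: vertex_reflexive_def frame_Fix_def G_def)
  then obtain t where t: "c = t *\<^sub>R v" by (auto simp: span_singleton)
  \<comment> \<open>Pairing with \<open>v\<close> identifies the multiple: the average has the same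
    inner product with \<open>v\<close> as \<open>x\<close>.\<close>
  have "inner v x = t * (norm v)\<^sup>2"
    using ic by (simp add: t power2_norm_eq_inner)
  then show ?thesis using cK t v(2) by simp
qed

section \<open>Assembling the dilation of \<open>X / d\<close>\<close>

theorem theorem8p5:
  fixes \<Phi> K :: "(real ^ 'd) set"
  assumes "tight_frame \<Phi>" and "isometric_frame \<Phi>" and "vertex_reflexive \<Phi>"
    and "K = convex hull \<Phi>"
  shows "Wmax K \<subseteq> scale_tuples (real CARD('d)) (Wmin K)"
proof
  fix X assume "X \<in> Wmax K"
  then obtain n where n: "n \<ge> 1" and X: "X \<in> Wmax_level n K" by (auto simp: Wmax_def)
  then have sa: "X \<in> sa_tuples n" by (simp add: Wmax_level_def)
  then have Xc: "X i \<in> carrier_mat n n" for i by (simp add: sa_tuples_def)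
  obtain \<sigma> where fin: "finite \<Phi>" and \<sigma>: "\<sigma> > 0" "\<And>x. (\<Sum>v\<in>\<Phi>. \<bar>inner x v\<bar>\<^sup>2) = \<sigma> * (norm x)\<^sup>2"
    using assms(1) by (auto simp: tight_frame_def)
  obtain l where l: "l > 0" "\<And>v. v \<in> \<Phi> \<Longrightarrow> norm v = l"
    using assms(2) by (auto simp: isometric_frame_def)
  note frame = frame_matrix[OF \<sigma>(2)]
  define M where "M = real (card \<Phi>)"
  define d where "d = real CARD('d)"
  have d: "d > 0" by (simp add: d_def)
  \<comment> \<open>The trace of the frame operator, computed once from the lengths of the vectors
    and once from its diagonal. This is where the factor \<open>d\<close> originates.\<close>
  have trace: "M * l\<^sup>2 = d * \<sigma>"
  proof -
    have "M * l\<^sup>2 = (\<Sum>v\<in>\<Phi>. inner v v)"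
      using l(2) by (simp add: M_def flip: power2_norm_eq_inner)
    also have "\<dots> = (\<Sum>i\<in>UNIV. \<Sum>v\<in>\<Phi>. v $ i * v $ i)"
      unfolding inner_vec_def by (subst sum.swap) simp
    finally show ?thesis by (simp add: frame d_def)
  qed
  have M: "M > 0"
    using trace d \<sigma>(1) by (metis M_def less_irrefl mult_pos_pos mult_zero_left of_nat_0_le_iff order_le_less)
  define A where "A v p q = (\<Sum>i\<in>UNIV. complex_of_real (v $ i) * X i $$ (p, q))" for v p q
  \<comment> \<open>All data attached to one frame vector, two coefficients and the rank ones for
    each, bundled so that they can be chosen simultaneously over \<Phi>.\<close>
  define P where "P v c w \<longleftrightarrow> (\<forall>b. (c b / l\<^sup>2) *\<^sub>R v \<in> K) \<and> (\<forall>p<n. \<forall>q<n.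
      (\<Sum>b\<in>UNIV. \<Sum>k<n. w b k p * cnj (w b k q)) = (if p = q then 1 else 0) \<and>
      (\<Sum>b\<in>UNIV. \<Sum>k<n. complex_of_real (c b) * (w b k p * cnj (w b k q))) = A v p q)"
    for v and c :: "bool \<Rightarrow> real" and w
  have "\<exists>c w. P v c w" if v: "v \<in> \<Phi>" for v
  proof -
    define lo where "lo = Min (inner v ` \<Phi>)"
    define hi where "hi = Max (inner v ` \<Phi>)"
    have ne: "\<Phi> \<noteq> {}" using v by auto
    have lohi: "lo \<in> inner v ` \<Phi>" "hi \<in> inner v ` \<Phi>"
      unfolding lo_def hi_def using fin ne by (auto intro!: Min_in Max_in simp del: image_iff)
    have v0: "v \<noteq> 0" using l v by fastforce
    \<comment> \<open>For \<open>t = inner v x\<close> this point is the projection of the frame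
      vector \<open>x\<close> onto the line of \<open>v\<close>. Hence the extreme values
      \<open>lo\<close> and \<open>hi\<close>, being attained on \<Phi>, give points of
      \<open>K\<close>.\<close>
    have pt: "(t / l\<^sup>2) *\<^sub>R v \<in> K" if "t \<in> inner v ` \<Phi>" for t
      using that vertex_reflexive_projection[OF fin assms(3) v v0] l(2)[OF v] assms(4) by auto
    have "K \<subseteq> {x. inner v x \<le> hi}" "K \<subseteq> {x. inner v x \<ge> lo}"
      unfolding assms(4) lo_def hi_def
      by (rule hull_minimal; use fin in \<open>auto simp: convex_halfspace_le convex_halfspace_ge\<close>)+
    \<comment> \<open>The maximal set is defined by upper bounds only, so the lower bound is
      restated for \<open>- v\<close>.\<close>
    then have K: "inner v x \<le> hi" "inner (- v) x \<le> - lo" if "x \<in> K" for x using that by auto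
    have "psd_on {..<n} (\<lambda>p q. (if p = q then of_real hi else 0) - A v p q)"
      using Wmax_level_psd_on[OF X K(1)] by (simp add: A_def)
    moreover have "psd_on {..<n} (\<lambda>p q. A v p q - (if p = q then of_real lo else 0))"
    proof -
      have "psd_on {..<n} (\<lambda>p q. (if p = q then of_real (- lo) else 0) -
          (\<Sum>i\<in>UNIV. complex_of_real ((- v) $ i) * X i $$ (p, q)))"
        by (rule Wmax_level_psd_on[OF X K(2)])
      also have "(\<lambda>p q. (if p = q then of_real (- lo) else 0) -
          (\<Sum>i\<in>UNIV. complex_of_real ((- v) $ i) * X i $$ (p, q))) =
          (\<lambda>p q. A v p q - (if p = q then of_real lo else 0))"
        by (intro ext) (simp add: A_def sum_negf)
      finally show ?thesis .
    qed
    moreover have "lo \<le> hi" unfolding lo_def hi_def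
      using fin ne by (simp add: Min_le_iff)
    ultimately obtain w where "\<forall>p\<in>{..<n}. \<forall>q\<in>{..<n}.
        (\<Sum>b\<in>UNIV. \<Sum>k<n. w b k p * cnj (w b k q)) = (if p = q then 1 else 0) \<and>
        (\<Sum>b\<in>UNIV. \<Sum>k<n. of_real (if b then hi else lo) * (w b k p * cnj (w b k q))) = A v p q"
      using rank_ones_between[of "{..<n}" lo hi "A v"] by blast
    then show ?thesis
      using pt lohi unfolding P_def by (intro exI[of _ "\<lambda>b. if b then hi else lo"] exI[of _ w]) auto
  qed
  then have "\<forall>v\<in>\<Phi>. \<exists>c w. P v c w" by (rule ballI)
  from bchoice[OF this] obtain c where "\<forall>v\<in>\<Phi>. \<exists>w. P v (c v) w" ..
  from bchoice[OF this] obtain w where P: "\<forall>v\<in>\<Phi>. P v (c v) (w v)" ..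
  have cK: "(c v b / l\<^sup>2) *\<^sub>R v \<in> K"
    and one: "p < n \<Longrightarrow> q < n \<Longrightarrow>
      (\<Sum>b\<in>UNIV. \<Sum>k<n. w v b k p * cnj (w v b k q)) = (if p = q then 1 else 0)"
    and cA: "p < n \<Longrightarrow> q < n \<Longrightarrow>
      (\<Sum>b\<in>UNIV. \<Sum>k<n. complex_of_real (c v b) * (w v b k p * cnj (w v b k q))) = A v p q"
    if "v \<in> \<Phi>" for v b p q
    using P that by (simp_all add: P_def)
  define I where "I = \<Phi> \<times> (UNIV :: bool set) \<times> {..<n}"
  define h where "h = (\<lambda>(v, b, k::nat). (c v b / l\<^sup>2) *\<^sub>R v)"
  \<comment> \<open>Each v contributes a resolution of the identity; the factor 1 / sqrt M turns
    their sum over \<Phi> into an average, again a resolution of the identity.\<close>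
  define u where "u = (\<lambda>(v, b, k) p. w v b k p / of_real (sqrt M))"
  have sumI: "(\<Sum>k\<in>I. f k) = (\<Sum>v\<in>\<Phi>. \<Sum>b\<in>UNIV. \<Sum>k<n. f (v, b, k))" for f :: "_ \<Rightarrow> complex"
    by (simp add: I_def sum.cartesian_product')
  have uu: "u (v, b, k) p * cnj (u (v, b, k) q) = w v b k p * cnj (w v b k q) / of_real M" for v b k p q
    using M by (simp add: u_def flip: of_real_mult)
  let ?Y = "\<lambda>i. complex_of_real (1 / d) \<cdot>\<^sub>m X i"
  have "?Y \<in> Wmin_level n K"
  proof (rule Wmin_level_of_finite_rank_ones[where I = I and h = h and w = u])
    show "?Y \<in> sa_tuples n" by (rule sa_tuples_scale[OF sa])
    show "finite I" using fin by (simp add: I_def)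
    show "h k \<in> K" if "k \<in> I" for k using that cK by (auto simp: I_def h_def)
    fix p q assume pq: "p < n" "q < n"
    show "(\<Sum>k\<in>I. u k p * cnj (u k q)) = (if p = q then 1 else 0)"
      unfolding sumI uu using M pq by (simp add: one M_def flip: sum_divide_distrib)
    fix i
    have "(\<Sum>k\<in>I. complex_of_real (h k $ i) * (u k p * cnj (u k q))) =
        (\<Sum>v\<in>\<Phi>. of_real (v $ i / (M * l\<^sup>2)) *
          (\<Sum>b\<in>UNIV. \<Sum>k<n. complex_of_real (c v b) * (w v b k p * cnj (w v b k q))))"
      unfolding sumI uu by (simp add: h_def sum_distrib_left mult_ac)
    \<comment> \<open>The factor 1 / M comes from averaging and 1 / l^2 from projecting;
      \<open>trace\<close> combines them into 1 / (d \<sigma>). The frame operator then contributes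
      \<sigma> on the diagonal and leaves X_i / d.\<close>
    also have "\<dots> = (\<Sum>v\<in>\<Phi>. \<Sum>j\<in>UNIV. of_real (v $ i * v $ j) * X j $$ (p, q) / of_real (d * \<sigma>))"
      by (simp add: cA pq A_def trace sum_distrib_left mult.assoc)
    also have "\<dots> = (\<Sum>j\<in>UNIV. of_real (\<Sum>v\<in>\<Phi>. v $ i * v $ j) * X j $$ (p, q) / of_real (d * \<sigma>))"
      by (subst sum.swap) (simp add: sum_distrib_right sum_divide_distrib)
    also have "\<dots> = (\<Sum>j\<in>UNIV. if j = i then of_real (1 / d) * X i $$ (p, q) else 0)"
      unfolding frame using \<sigma>(1) by (intro sum.cong) auto
    also have "\<dots> = ?Y i $$ (p, q)"
      using Xc[of i] pq by simp
    finally show "?Y i $$ (p, q) = (\<Sum>k\<in>I. complex_of_real (h k $ i) * (u k p * cnj (u k q)))" ..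
  qed
  then have "?Y \<in> Wmin K" using n by (auto simp: Wmin_def)
  moreover have "X = (\<lambda>i. complex_of_real d \<cdot>\<^sub>m ?Y i)"
    using d by (intro ext eq_matI) auto
  ultimately show "X \<in> scale_tuples (real CARD('d)) (Wmin K)"
    unfolding scale_tuples_def d_def by (intro image_eqI)
qed

end
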